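(* Let $(A,\omega)$ be an anti-pre-Lie algebra, with product $x\cdot y=\omega(x,y)$, and let $\omega_t=\omega+\sum_{i=1}^{+\infty}\omega_it^i$ be a $1$-parameter formal deformation of $(A,\omega)$. Then $\omega_1$ is a $2$-cocycle of the anti-pre-Lie algebra $(A,\omega)$ with coefficients in the regular representation.
   Context: Let $\mathbb K$ be the ground field. An anti-pre-Lie algebra is a vector space (or $\mathbb K[[t]]$-module) $A$ with a bilinear product $\cdot$ such that for all $x,y,z$, with $[x,y]=x\cdot y-y\cdot x$: (1) $x\cdot(y\cdot z)-y\cdot(x\cdot z)=[y,x]\cdot z$; (2) $[x,y]\cdot z+[y,z]\cdot x+[z,x]\cdot y=0$. The product is also written $\omega(x,y)=x\cdot y$. A $1$-parameter formal deformation of $(A,\omega)$ is a $\mathbb K[[t]]$-bilinear map $\omega_t=\omega+\sum_{i\ge1}\omega_it^i:A[[t]]\otimes A[[t]]\to A[[t]]$, where each $\omega_i:A\otimes A\to A$ is linear (and $\omega_0=\omega$), i.e. $\omega_t(\sum_i a_it^i,\sum_j b_jt^j)=\sum_{i,j,k}\omega_k(a_i,b_j)t^{i+j+k}$, such that $(A[[t]],\omega_t)$ is an anti-pre-Lie algebra. The regular representation of $(A,\cdot)$ is $(A,L,R)$ with $L_xy=x\cdot y$, $R_xy=y\cdot x$. A 2-cocycle with coefficients in the regular representation is a linear map $f:A\otimes A\to A$ such that for all $x,y,z\in A$, $x\cdot f(y,z)-y\cdot f(x,z)-f(y,x)\cdot z+f(x,y)\cdot z-f(y,x\cdot z)+f(x,y\cdot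 z)+f([x,y],z)=0$ and $(f(y,z)-f(z,y))\cdot x+(f(z,x)-f(x,z))\cdot y+(f(x,y)-f(y,x))\cdot z+f([x,y],z)+f([y,z],x)+f([z,x],y)=0$. *)

theory Defs
  imports "HOL-Computational_Algebra.Formal_Power_Series"
begin

text \<open>Over a field a module is a vector space, and a linear map \<open>A \<otimes> A \<rightarrow> A\<close> is given by the
  corresponding bilinear map \<open>A \<times> A \<rightarrow> A\<close>.\<close>

definition bilinear_op ::
    "('r::comm_ring_1 \<Rightarrow> 'a::ab_group_add \<Rightarrow> 'a) \<Rightarrow> ('a \<Rightarrow> 'a \<Rightarrow> 'a) \<Rightarrow> bool" where
  "bilinear_op scale f \<longleftrightarrow>
     (\<forall>x. module_hom scale scale (\<lambda>y. f x y)) \<and> (\<forall>y. module_hom scale scale (\<lambda>x. f x y))"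

definition commutator :: "('a::ab_group_add \<Rightarrow> 'a \<Rightarrow> 'a) \<Rightarrow> 'a \<Rightarrow> 'a \<Rightarrow> 'a" where
  "commutator f x y = f x y - f y x"

text \<open>The scalars form an arbitrary commutative ring, so that the same notion applies over the
  field \<open>K\<close> and over \<open>K[[t]]\<close>.\<close>

locale anti_pre_lie_algebra = module scale
  for scale :: "'r::comm_ring_1 \<Rightarrow> 'a::ab_group_add \<Rightarrow> 'a" +
  fixes mul :: "'a \<Rightarrow> 'a \<Rightarrow> 'a"
  assumes bilinear_mul: "bilinear_op scale mul"
    and mul_left_comm:
      "mul x (mul y z) - mul y (mul x z) = mul (commutator mul y x) z"
    and mul_commutator_cyclic:
      "mul (commutator mul x y) z + mul (commutator mul y z) x + mul (commutator mul z x) y = 0"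

text \<open>The action of \<open>K[[t]]\<close> on \<open>A[[t]]\<close>, where \<open>A[[t]]\<close> is represented by the type of formal
  power series with coefficients in \<open>A\<close>.\<close>

definition fps_scale ::
    "('k::comm_ring_1 \<Rightarrow> 'a::ab_group_add \<Rightarrow> 'a) \<Rightarrow> 'k fps \<Rightarrow> 'a fps \<Rightarrow> 'a fps" where
  "fps_scale scale p a = Abs_fps (\<lambda>n. \<Sum>i\<le>n. scale (fps_nth p i) (fps_nth a (n - i)))"

text \<open>The map \<open>\<omega>\<^sub>t\<close> determined by the family of its coefficients: the sum of all
  \<open>\<omega>\<^sub>k(a\<^sub>i, b\<^sub>j) t\<^bsup>i+j+k\<^esup>\<close>.\<close>

definition fps_op :: "(nat \<Rightarrow> 'a::ab_group_add \<Rightarrow> 'a \<Rightarrow> 'a) \<Rightarrow> 'a fps \<Rightarrow> 'a fps \<Rightarrow> 'a fps" where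
  "fps_op \<omega>s a b =
     Abs_fps (\<lambda>n. \<Sum>(i, j, k) \<in> {(i, j, k). i + j + k = n}. \<omega>s k (fps_nth a i) (fps_nth b j))"

definition formal_deformation ::
    "('k::field \<Rightarrow> 'a::ab_group_add \<Rightarrow> 'a) \<Rightarrow> ('a \<Rightarrow> 'a \<Rightarrow> 'a) \<Rightarrow> (nat \<Rightarrow> 'a \<Rightarrow> 'a \<Rightarrow> 'a) \<Rightarrow> bool" where
  "formal_deformation scale \<omega> \<omega>s \<longleftrightarrow>
     \<omega>s 0 = \<omega> \<and> (\<forall>i. bilinear_op scale (\<omega>s i)) \<and>
     anti_pre_lie_algebra (fps_scale scale) (fps_op \<omega>s)"

definition two_cocycle_regular ::
    "('k::field \<Rightarrow> 'a::ab_group_add \<Rightarrow> 'a) \<Rightarrow> ('a \<Rightarrow> 'a \<Rightarrow> 'a) \<Rightarrow> ('a \<Rightarrow> 'a \<Rightarrow> 'a) \<Rightarrow> bool" where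
  "two_cocycle_regular scale mul f \<longleftrightarrow>
     bilinear_op scale f \<and>
     (\<forall>x y z. mul x (f y z) - mul y (f x z) - mul (f y x) z + mul (f x y) z
        - f y (mul x z) + f x (mul y z) + f (commutator mul x y) z = 0) \<and>
     (\<forall>x y z. mul (f y z - f z y) x + mul (f z x - f x z) y + mul (f x y - f y x) z
        + f (commutator mul x y) z + f (commutator mul y z) x + f (commutator mul z x) y = 0)"

lemma finite_index_triples: "finite {(i, j, k). i + j + k = (n::nat)}"
  by (rule finite_subset[of _ "{..n} \<times> {..n} \<times> {..n}"]) auto

lemma module_fps_scale:
  fixes scale :: "'k::comm_ring_1 \<Rightarrow> 'a::ab_group_add \<Rightarrow> 'a"
  assumes "module scale"
  shows "module (fps_scale scale)"
proof -
  interpret module scale by fact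
  have assoc: "fps_scale scale p (fps_scale scale q a) = fps_scale scale (p * q) a" for p q a
  proof (rule fps_ext)
    fix n
    have "fps_nth (fps_scale scale p (fps_scale scale q a)) n =
        (\<Sum>i\<le>n. \<Sum>j\<le>n - i. scale (fps_nth p i * fps_nth q j) (fps_nth a (n - i - j)))"
      by (simp add: fps_scale_def scale_sum_right)
    also have "\<dots> = (\<Sum>(i, j)\<in>{(i, j). i + j \<le> n}.
        scale (fps_nth p i * fps_nth q j) (fps_nth a (n - (i + j))))"
    proof -
      have "{(i, j). i + j \<le> n} = Sigma {..n} (\<lambda>i. {..n - i})" by auto
      then show ?thesis by (simp add: sum.Sigma)
    qed
    also have "\<dots> = (\<Sum>m\<le>n. \<Sum>i\<le>m. scale (fps_nth p i * fps_nth q (m - i)) (fps_nth a (n - m)))"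
      by (simp add: sum.triangle_reindex_eq)
    also have "\<dots> = fps_nth (fps_scale scale (p * q) a) n"
      by (simp add: fps_scale_def fps_mult_nth scale_sum_left atLeast0AtMost)
    finally show "fps_nth (fps_scale scale p (fps_scale scale q a)) n =
        fps_nth (fps_scale scale (p * q) a) n" .
  qed
  have one: "fps_scale scale 1 a = a" for a
    by (rule fps_ext) (simp add: fps_scale_def if_distrib[of "\<lambda>c. scale c _"] sum.If_cases cong: if_cong)
  have distrib: "fps_scale scale p (a + b) = fps_scale scale p a + fps_scale scale p b"
    "fps_scale scale (p + q) a = fps_scale scale p a + fps_scale scale q a" for p q a b
    by (simp_all add: fps_scale_def fps_eq_iff scale_right_distrib scale_left_distrib sum.distrib)
  show ?thesis
    by (intro module.intro distrib assoc one)
qed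

end

theory Submission imports Defs begin

text \<open>The cocycle condition is the first-order part of the deformed identities. Evaluate both
  identities of \<open>fps_op \<omega>s\<close> on constant series and compare coefficients of
  \<open>t\<close>. In a double product each of the two multiplications may supply the degree, so
  \<open>(x y) z\<close> contributes
  \<open>\<omega>s 1 (\<omega> x y) z + \<omega> (\<omega>s 1 x y) z\<close>, and
  \<open>x (y z)\<close> likewise. \<open>fps_op_nth_0\<close> and \<open>fps_op_nth_1\<close> give
  these coefficients; bilinearity does the rest.\<close>

text \<open>The zero laws remove the degree-one coefficients of constant series. Subtraction in the
  first argument suffices because commutators occur only as left factors.\<close>

lemma bilinear_op_linear:
  assumes "bilinear_op scale f"
  shows "f x 0 = 0" "f 0 y = 0"
    and "f (x - x') y = f x y - f x' y"
proof -
  interpret right: module_hom scale scale "\<lambda>y. f x y" for x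
    using assms by (auto simp: bilinear_op_def)
  interpret left: module_hom scale scale "\<lambda>x. f x y" for y
    using assms by (auto simp: bilinear_op_def)
  show "f x 0 = 0" "f 0 y = 0" "f (x - x') y = f x y - f x' y"
    by (rule right.zero left.zero left.diff)+
qed

lemma fps_op_nth_0: "fps_nth (fps_op \<omega>s a b) 0 = \<omega>s 0 (fps_nth a 0) (fps_nth b 0)"
proof -
  have "{(i, j, k). i + j + k = (0::nat)} = {(0, 0, 0)}" by auto
  then show ?thesis by (simp add: fps_op_def)
qed

text \<open>The series are arbitrary, not constant: a product of constants, which reappears as a
  factor in a double product, may have a nonzero coefficient of \<open>t\<close>.\<close>

lemma fps_op_nth_1:
  "fps_nth (fps_op \<omega>s a b) 1 = \<omega>s 1 (fps_nth a 0) (fps_nth b 0)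
     + \<omega>s 0 (fps_nth a 1) (fps_nth b 0) + \<omega>s 0 (fps_nth a 0) (fps_nth b 1)"
proof -
  have "{(i, j, k). i + j + k = (1::nat)} = {(0, 0, 1), (1, 0, 0), (0, 1, 0)}" by auto
  then show ?thesis by (simp add: fps_op_def add.assoc)
qed

theorem proposition4p2:
  fixes scale :: "'k::field \<Rightarrow> 'a::ab_group_add \<Rightarrow> 'a"
    and \<omega> :: "'a \<Rightarrow> 'a \<Rightarrow> 'a"
    and \<omega>s :: "nat \<Rightarrow> 'a \<Rightarrow> 'a \<Rightarrow> 'a"
  assumes "anti_pre_lie_algebra scale \<omega>"
    and "formal_deformation scale \<omega> \<omega>s"
  shows "two_cocycle_regular scale \<omega> (\<omega>s 1)"
proof -
  have \<omega>: "\<omega>s 0 = \<omega>" and bilinear: "bilinear_op scale (\<omega>s i)" for i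
    using assms(2) by (auto simp: formal_deformation_def)
  interpret deformed: anti_pre_lie_algebra "fps_scale scale" "fps_op \<omega>s"
    using assms(2) by (simp add: formal_deformation_def)
  \<comment> \<open>The second copy is stated for \<open>\<omega>\<close>, since rewriting
    \<open>\<omega>s 0\<close> to \<open>\<omega>\<close> leaves terms that the first no longer
    matches.\<close>
  note linear = bilinear_op_linear[OF bilinear] bilinear_op_linear[OF bilinear[of 0], unfolded \<omega>]
  note coeffs = fps_op_nth_0 fps_op_nth_1[unfolded One_nat_def] commutator_def \<omega> linear
  show ?thesis
    unfolding two_cocycle_regular_def
  proof (intro conjI allI)
    show "bilinear_op scale (\<omega>s 1)" by (rule bilinear)
  next
    fix x y z
    show "\<omega> x (\<omega>s 1 y z) - \<omega> y (\<omega>s 1 x z) - \<omega> (\<omega>s 1 y x) z + \<omega> (\<omega>s 1 x y) z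
        - \<omega>s 1 y (\<omega> x z) + \<omega>s 1 x (\<omega> y z) + \<omega>s 1 (commutator \<omega> x y) z = 0"
      \<comment> \<open>The right-hand side carries \<open>[y, x]\<close>; moved to the left and
        split by linearity, it gives the terms with \<open>\<omega>s 1 x y\<close> and
        \<open>[x, y]\<close> their positive sign.\<close>
      using arg_cong[OF deformed.mul_left_comm[of "fps_const x" "fps_const y" "fps_const z"],
          of "\<lambda>a. fps_nth a 1"]
      by (simp add: coeffs algebra_simps)
  next
    fix x y z
    show "\<omega> (\<omega>s 1 y z - \<omega>s 1 z y) x + \<omega> (\<omega>s 1 z x - \<omega>s 1 x z) y + \<omega> (\<omega>s 1 x y - \<omega>s 1 y x) z
        + \<omega>s 1 (commutator \<omega> x y) z + \<omega>s 1 (commutator \<omega> y z) x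
        + \<omega>s 1 (commutator \<omega> z x) y = 0"
      \<comment> \<open>Each cyclic summand splits in two: the degree falls either on the inner
        commutator or on the outer product.\<close>
      using arg_cong[OF deformed.mul_commutator_cyclic[of "fps_const x" "fps_const y" "fps_const z"],
          of "\<lambda>a. fps_nth a 1"]
      by (simp add: coeffs algebra_simps)
  qed
qed

end
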